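(* Let $F$ be a graph with at least $3$ vertices and let $r\ge 2$ be an integer. Suppose there are constants $C_1,C_2>0$ and reals $\alpha>1$, $\beta>1$ such that for all positive integers $n$, $\mathrm{ex}(n,F)\le C_1 n^{\alpha}$ and $\min_{v_0\in V(F)}\mathrm{ex}(n,K_r,F-v_0)\le C_2 n^{\beta}$. Then there exists a constant $C=C(C_1,C_2,\alpha,\beta,F)$ such that for all $m$, $$\mathrm{mex}(m,K_{r+1},F)\le C m^{f(\alpha,\beta)},\qquad\text{where } f(\alpha,\beta)=1+(\beta-1)\left(1-\frac{1}{\alpha}\right).$$
   Context: All graphs are finite and simple. $\mathrm{ex}(n,F)$ is the maximum number of edges in an $F$-free graph on $n$ vertices; $\mathrm{ex}(n,K_r,H)$ is the maximum number of copies of $K_r$ in an $H$-free graph on $n$ vertices; $\mathrm{mex}(m,K_{r+1},F)$ is the maximum number of copies of $K_{r+1}$ in an $F$-free graph with $m$ edges. $F-v_0$ denotes the graph obtained from $F$ by deleting the vertex $v_0$. *)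

theory Defs
  imports Complex_Main
begin

datatype 'a ugraph = UGraph (verts: "'a set") (edges: "'a set set")

definition simple_graph :: "'a ugraph \<Rightarrow> bool" where
  "simple_graph G \<longleftrightarrow> finite (verts G) \<and> edges G \<subseteq> {e. e \<subseteq> verts G \<and> card e = 2}"

definition subgraph_of :: "'a ugraph \<Rightarrow> 'a ugraph \<Rightarrow> bool" where
  "subgraph_of S G \<longleftrightarrow> simple_graph S \<and> verts S \<subseteq> verts G \<and> edges S \<subseteq> edges G"

definition graph_iso :: "'a ugraph \<Rightarrow> 'b ugraph \<Rightarrow> bool" where
  "graph_iso H G \<longleftrightarrow>
     (\<exists>\<phi>. bij_betw \<phi> (verts H) (verts G) \<and> (\<lambda>e. \<phi> ` e) ` edges H = edges G)"

text \<open>Copies are (not necessarily induced) subgraphs, so they are counted without labelling.\<close>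

definition copies :: "'a ugraph \<Rightarrow> 'b ugraph \<Rightarrow> 'b ugraph set" where
  "copies H G = {S. subgraph_of S G \<and> graph_iso H S}"

definition free_of :: "'a ugraph \<Rightarrow> 'b ugraph \<Rightarrow> bool" where
  "free_of F G \<longleftrightarrow> copies F G = {}"

definition complete_graph :: "nat \<Rightarrow> nat ugraph" where
  "complete_graph r = UGraph {..<r} {e. e \<subseteq> {..<r} \<and> card e = 2}"

definition del_vertex :: "'a ugraph \<Rightarrow> 'a \<Rightarrow> 'a ugraph" where
  "del_vertex G v = UGraph (verts G - {v}) {e \<in> edges G. v \<notin> e}"

text \<open>
  Host graphs have vertices in \<^typ>\<open>nat\<close>, which realises every finite graph up to isomorphism.
  On \<^typ>\<open>nat\<close>, \<^const>\<open>Sup\<close> of a nonempty finite set is its maximum. It is \<open>0\<close> on the empty set,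
  which only occurs when no admissible \<open>F\<close>-free graph exists (e.g. \<open>F\<close> has no edges and at most
  \<open>n\<close> vertices).
\<close>

definition ex_edges :: "nat \<Rightarrow> 'a ugraph \<Rightarrow> nat" where
  "ex_edges n F =
     Sup {card (edges G) | G :: nat ugraph. simple_graph G \<and> card (verts G) = n \<and> free_of F G}"

definition ex_copies :: "nat \<Rightarrow> 'b ugraph \<Rightarrow> 'a ugraph \<Rightarrow> nat" where
  "ex_copies n H F =
     Sup {card (copies H G) | G :: nat ugraph. simple_graph G \<and> card (verts G) = n \<and> free_of F G}"

text \<open>
  The number of vertices is unrestricted here. The set is nevertheless finite whenever \<open>H\<close> has no
  isolated vertices, in particular for complete graphs on at least two vertices: a copy of \<open>H\<close>
  is then determined by its set of edges, so there are at most \<open>2 ^ m\<close> of them.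
\<close>

definition mex :: "nat \<Rightarrow> 'b ugraph \<Rightarrow> 'a ugraph \<Rightarrow> nat" where
  "mex m H F =
     Sup {card (copies H G) | G :: nat ugraph. simple_graph G \<and> card (edges G) = m \<and> free_of F G}"

end

theory Submission
  imports Defs
begin

text \<open>
  Let \<open>G\<close> be \<open>F\<close>-free with at most \<open>m\<close> edges. A graph on \<open>n\<close> vertices whose degrees all exceed \<open>D\<close>
  has more than \<open>n D / 2\<close> edges, which for \<open>D \<ge> c m powr (1 - 1 / \<alpha>)\<close> is incompatible with having at
  most \<open>m\<close> and at most \<open>C1 n powr \<alpha>\<close> edges; so every nonempty subgraph of \<open>G\<close> has a vertex \<open>v\<close> of
  degree \<open>d \<le> D\<close>. The neighbourhood of \<open>v\<close> contains no \<open>F - v\<^sub>0\<close>, hence \<open>v\<close> lies in at most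
  \<open>C2 d powr \<beta> \<le> C2 D powr (\<beta> - 1) d\<close> cliques of size \<open>r + 1\<close>. Deleting such vertices one after the
  other charges at most \<open>C2 D powr (\<beta> - 1)\<close> cliques to each edge.
\<close>

text \<open>A clique is recorded by its vertex set alone, so that passing to a vertex-deleted graph
  or to a neighbourhood becomes plain set manipulation.\<close>

definition cliques :: "nat \<Rightarrow> 'a ugraph \<Rightarrow> 'a set set" where
  "cliques r G = {S. S \<subseteq> verts G \<and> card S = r \<and> {e. e \<subseteq> S \<and> card e = 2} \<subseteq> edges G}"

definition neighbors :: "'a ugraph \<Rightarrow> 'a \<Rightarrow> 'a set" where
  "neighbors G v = {u. {v, u} \<in> edges G}"

text \<open>The vertex set is \<open>N\<close> itself, not its intersection with
  \<open>verts G\<close>: the graph induced on \<open>neighbors G v\<close> then has exactly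
  \<open>card (neighbors G v)\<close> vertices, which is the argument at which
  \<open>ex_copies\<close> is evaluated later.\<close>

definition induced :: "'a ugraph \<Rightarrow> 'a set \<Rightarrow> 'a ugraph" where
  "induced G N = UGraph N {e \<in> edges G. e \<subseteq> N}"

section \<open>Degrees, edge counts and vertex deletion\<close>

lemma finite_edges: "simple_graph G \<Longrightarrow> finite (edges G)"
  unfolding simple_graph_def by (rule finite_subset[of _ "Pow (verts G)"]) auto

lemma card_edges_le: "simple_graph G \<Longrightarrow> card (edges G) \<le> 2 ^ card (verts G)"
  unfolding simple_graph_def
  by (metis (no_types, lifting) Ball_Collect PowI card_Pow card_mono finite_Pow_iff subsetI)

lemma neighbors_subset:
  assumes "simple_graph G"
  shows "neighbors G v \<subseteq> verts G - {v}"
proof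
  fix u assume "u \<in> neighbors G v"
  then have "{v, u} \<subseteq> verts G" "card {v, u} = 2"
    using assms unfolding neighbors_def simple_graph_def by blast+
  then show "u \<in> verts G - {v}" by auto
qed

lemma card_neighbors:
  assumes "simple_graph G"
  shows "card (neighbors G v) = card {e \<in> edges G. v \<in> e}"
proof (rule bij_betw_same_card)
  show "bij_betw (\<lambda>u. {v, u}) (neighbors G v) {e \<in> edges G. v \<in> e}"
    unfolding bij_betw_def
  proof
    show "inj_on (\<lambda>u. {v, u}) (neighbors G v)"
      by (auto simp: inj_on_def doubleton_eq_iff)
    show "(\<lambda>u. {v, u}) ` neighbors G v = {e \<in> edges G. v \<in> e}"
    proof
      show "{e \<in> edges G. v \<in> e} \<subseteq> (\<lambda>u. {v, u}) ` neighbors G v"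
      proof
        fix e assume e: "e \<in> {e \<in> edges G. v \<in> e}"
        then have "card e = 2" using assms unfolding simple_graph_def by auto
        then obtain x y where "e = {x, y}" by (auto simp: card_2_iff)
        then have "\<exists>u. e = {v, u}" using e by auto
        then show "e \<in> (\<lambda>u. {v, u}) ` neighbors G v"
          using e by (auto simp: neighbors_def)
      qed
    qed (auto simp: neighbors_def)
  qed
qed

text \<open>Handshake identity: incident pairs are counted once by vertices and once by
  edges.\<close>

lemma sum_card_neighbors:
  assumes "simple_graph G"
  shows "(\<Sum>v\<in>verts G. card (neighbors G v)) = 2 * card (edges G)"
proof -
  have "\<forall>e\<in>edges G. card {v \<in> verts G. v \<in> e} = 2"
  proof
    fix e assume "e \<in> edges G"
    then have "e \<subseteq> verts G" "card e = 2" using assms unfolding simple_graph_def by auto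
    moreover from this have "{v \<in> verts G. v \<in> e} = e" by auto
    ultimately show "card {v \<in> verts G. v \<in> e} = 2" by simp
  qed
  then have "(\<Sum>v\<in>verts G. card {e \<in> edges G. v \<in> e}) = 2 * card (edges G)"
    using assms finite_edges[OF assms]
    by (intro sum_multicount) (auto simp: simple_graph_def)
  then show ?thesis by (simp add: card_neighbors[OF assms])
qed

lemma card_edges_del_vertex:
  assumes "simple_graph G"
  shows "card (edges G) = card (edges (del_vertex G v)) + card (neighbors G v)"
proof -
  have "edges G = edges (del_vertex G v) \<union> {e \<in> edges G. v \<in> e}"
    by (auto simp: del_vertex_def)
  moreover have "edges (del_vertex G v) \<inter> {e \<in> edges G. v \<in> e} = {}"
    by (auto simp: del_vertex_def)
  ultimately show ?thesis
    using finite_edges[OF assms] card_neighbors[OF assms, of v]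
    by (metis card_Un_disjoint finite_Un)
qed

lemma simple_graph_del_vertex: "simple_graph G \<Longrightarrow> simple_graph (del_vertex G v)"
  by (auto simp: simple_graph_def del_vertex_def)

lemma simple_graph_induced:
  "simple_graph G \<Longrightarrow> N \<subseteq> verts G \<Longrightarrow> simple_graph (induced G N)"
  by (auto simp: simple_graph_def induced_def intro: finite_subset)

lemma free_of_mono:
  "free_of F G \<Longrightarrow> verts H \<subseteq> verts G \<Longrightarrow> edges H \<subseteq> edges G \<Longrightarrow> free_of F H"
  by (fastforce simp: free_of_def copies_def subgraph_of_def)

lemma free_of_del_vertex: "free_of F G \<Longrightarrow> free_of F (del_vertex G v)"
  by (erule free_of_mono) (auto simp: del_vertex_def)

text \<open>Deliberately crude. What matters is that the bound depends on \<open>G\<close> only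
  through its number of vertices, so that the set under \<open>Sup\<close> in
  \<open>ex_copies\<close> is bounded above.\<close>

lemma card_copies_le:
  assumes "simple_graph G"
  shows "card (copies H G) \<le> 2 ^ card (verts G) * 2 ^ (2 ^ card (verts G))"
proof -
  let ?f = "\<lambda>S. (verts S, edges S)"
  have inj: "inj_on ?f (copies H G)"
    by (auto simp: inj_on_def intro: ugraph.expand)
  have sub: "?f ` copies H G \<subseteq> Pow (verts G) \<times> Pow (edges G)"
    by (auto simp: copies_def subgraph_of_def)
  have fin: "finite (Pow (verts G) \<times> Pow (edges G))"
    using assms finite_edges[OF assms] by (auto simp: simple_graph_def)
  have "card (copies H G) \<le> card (Pow (verts G) \<times> Pow (edges G))"
    using inj sub fin by (rule card_inj_on_le)
  also have "\<dots> = 2 ^ card (verts G) * 2 ^ card (edges G)"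
    using assms finite_edges[OF assms]
    by (simp add: card_cartesian_product card_Pow simple_graph_def)
  also have "\<dots> \<le> 2 ^ card (verts G) * 2 ^ (2 ^ card (verts G))"
    using card_edges_le[OF assms] by simp
  finally show "card (copies H G) \<le> 2 ^ card (verts G) * 2 ^ (2 ^ card (verts G))" .
qed

section \<open>Copies of complete graphs as cliques\<close>

lemma graph_iso_complete_iff:
  assumes "simple_graph S"
  shows "graph_iso (complete_graph r) S \<longleftrightarrow>
    card (verts S) = r \<and> edges S = {e. e \<subseteq> verts S \<and> card e = 2}"
proof -
  \<comment> \<open>Every bijection carries the pairs of its domain onto the pairs of its range. One
    direction below applies this to the given isomorphism, the other to an arbitrary enumeration of
    \<open>verts S\<close>.\<close>
  have img: "(\<lambda>e. f ` e) ` {e. e \<subseteq> {..<r} \<and> card e = 2} = {e. e \<subseteq> verts S \<and> card e = 2}"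
    if f: "bij_betw f {..<r} (verts S)" for f :: "nat \<Rightarrow> 'a"
  proof
    have inj: "inj_on f {..<r}" and im: "f ` {..<r} = verts S"
      using f by (auto simp: bij_betw_def)
    show "(\<lambda>e. f ` e) ` {e. e \<subseteq> {..<r} \<and> card e = 2} \<subseteq> {e. e \<subseteq> verts S \<and> card e = 2}"
      using im inj by (auto simp: card_image inj_on_subset)
    show "{e. e \<subseteq> verts S \<and> card e = 2} \<subseteq> (\<lambda>e. f ` e) ` {e. e \<subseteq> {..<r} \<and> card e = 2}"
    proof
      fix e assume e: "e \<in> {e. e \<subseteq> verts S \<and> card e = 2}"
      then obtain e' where e': "e' \<subseteq> {..<r}" "e = f ` e'"
        using im by (metis (no_types, lifting) mem_Collect_eq subset_imageE)
      then have "card e' = 2" using e inj by (auto simp: card_image inj_on_subset)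
      then show "e \<in> (\<lambda>e. f ` e) ` {e. e \<subseteq> {..<r} \<and> card e = 2}" using e' by auto
    qed
  qed
  show ?thesis
  proof
    assume "graph_iso (complete_graph r) S"
    then obtain f where f: "bij_betw f {..<r} (verts S)"
      "(\<lambda>e. f ` e) ` {e. e \<subseteq> {..<r} \<and> card e = 2} = edges S"
      by (auto simp: graph_iso_def complete_graph_def)
    then show "card (verts S) = r \<and> edges S = {e. e \<subseteq> verts S \<and> card e = 2}"
      using img[OF f(1)] bij_betw_same_card[OF f(1)] by simp
  next
    assume S: "card (verts S) = r \<and> edges S = {e. e \<subseteq> verts S \<and> card e = 2}"
    have "finite (verts S)" using assms by (simp add: simple_graph_def)
    then obtain f where "bij_betw f {..<r} (verts S)"
      using S ex_bij_betw_nat_finite by (metis atLeast0LessThan)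
    then show "graph_iso (complete_graph r) S"
      using img S unfolding graph_iso_def complete_graph_def ugraph.sel by metis
  qed
qed

text \<open>A complete subgraph is determined by its vertex set, so \<open>verts\<close> is a
  bijection between the two families.\<close>

lemma card_copies_complete:
  assumes "simple_graph G"
  shows "card (copies (complete_graph r) G) = card (cliques r G)"
proof (rule bij_betw_same_card)
  show "bij_betw verts (copies (complete_graph r) G) (cliques r G)"
    unfolding bij_betw_def
  proof
    show "inj_on verts (copies (complete_graph r) G)"
    proof (rule inj_onI)
      fix S T assume "S \<in> copies (complete_graph r) G" "T \<in> copies (complete_graph r) G"
        and eq: "verts S = verts T"
      then have "edges S = edges T"
        by (auto simp: copies_def subgraph_of_def graph_iso_complete_iff)
      then show "S = T" using eq by (simp add: ugraph.expand)
    qed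
    show "verts ` copies (complete_graph r) G = cliques r G"
    proof
      show "verts ` copies (complete_graph r) G \<subseteq> cliques r G"
        by (auto simp: copies_def subgraph_of_def graph_iso_complete_iff cliques_def)
      show "cliques r G \<subseteq> verts ` copies (complete_graph r) G"
      proof
        fix S assume S: "S \<in> cliques r G"
        let ?S = "UGraph S {e. e \<subseteq> S \<and> card e = 2}"
        have "simple_graph ?S"
          using S assms by (auto simp: simple_graph_def cliques_def intro: finite_subset)
        then have "?S \<in> copies (complete_graph r) G"
          using S by (auto simp: copies_def subgraph_of_def graph_iso_complete_iff cliques_def)
        then show "S \<in> verts ` copies (complete_graph r) G"
          by (metis image_eqI ugraph.sel(1))
      qed
    qed
  qed
qed

section \<open>Cliques through a vertex and its neighbourhood\<close>

lemma finite_cliques: "simple_graph G \<Longrightarrow> finite (cliques r G)"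
  by (rule finite_subset[of _ "Pow (verts G)"]) (auto simp: cliques_def simple_graph_def)

text \<open>A clique avoiding \<open>v\<close> survives the deletion of \<open>v\<close>; a clique
  containing \<open>v\<close> loses one vertex and becomes a clique among the neighbours of
  \<open>v\<close>.\<close>

lemma card_cliques_Suc_le:
  assumes G: "simple_graph G"
  shows "card (cliques (Suc r) G) \<le>
    card (cliques (Suc r) (del_vertex G v)) + card (cliques r (induced G (neighbors G v)))"
proof -
  let ?N = "induced G (neighbors G v)"
  have "cliques (Suc r) G \<subseteq> cliques (Suc r) (del_vertex G v) \<union> insert v ` cliques r ?N"
  proof
    fix S assume S: "S \<in> cliques (Suc r) G"
    show "S \<in> cliques (Suc r) (del_vertex G v) \<union> insert v ` cliques r ?N"
    proof (cases "v \<in> S")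
      case False
      then show ?thesis using S by (auto simp: cliques_def del_vertex_def)
    next
      case True
      have "finite S" using S by (auto simp: cliques_def intro: card_ge_0_finite)
      moreover have nb: "S - {v} \<subseteq> neighbors G v"
      proof
        fix u assume "u \<in> S - {v}"
        then have "{v, u} \<subseteq> S" "card {v, u} = 2" using True by auto
        then show "u \<in> neighbors G v" using S unfolding cliques_def neighbors_def by blast
      qed
      ultimately have "S - {v} \<in> cliques r ?N"
        using S True by (auto simp: cliques_def induced_def)
      then show ?thesis using True by (metis UnI2 image_eqI insert_Diff)
    qed
  qed
  moreover have fin: "finite (cliques (Suc r) (del_vertex G v))" "finite (cliques r ?N)"
    using G neighbors_subset[OF G, of v]
    by (auto intro!: finite_cliques simple_graph_del_vertex simple_graph_induced)
  ultimately have "card (cliques (Suc r) G)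
      \<le> card (cliques (Suc r) (del_vertex G v) \<union> insert v ` cliques r ?N)"
    by (intro card_mono) auto
  also have "\<dots> \<le> card (cliques (Suc r) (del_vertex G v)) + card (insert v ` cliques r ?N)"
    by (rule card_Un_le)
  also have "\<dots> \<le> card (cliques (Suc r) (del_vertex G v)) + card (cliques r ?N)"
    using card_image_le[OF fin(2)] by simp
  finally show ?thesis .
qed

text \<open>A copy of \<open>F\<close> minus \<open>w\<close> among the neighbours of
  \<open>v\<close> would extend to a copy of \<open>F\<close> in \<open>G\<close> by sending
  \<open>w\<close> to \<open>v\<close>: edges at \<open>w\<close> go to edges at \<open>v\<close>
  because all other images are neighbours of \<open>v\<close>.\<close>

lemma free_of_del_vertex_neighborhood:
  assumes G: "simple_graph G" and free: "free_of F G" and F: "simple_graph F"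
    and v: "v \<in> verts G" and w: "w \<in> verts F"
  shows "free_of (del_vertex F w) (induced G (neighbors G v))"
proof (rule ccontr)
  let ?N = "neighbors G v"
  assume "\<not> ?thesis"
  then obtain S f where S: "simple_graph S" "verts S \<subseteq> ?N" "edges S \<subseteq> edges G"
    and f: "bij_betw f (verts F - {w}) (verts S)"
    and fe: "(\<lambda>e. f ` e) ` {e \<in> edges F. w \<notin> e} = edges S"
    by (auto simp: free_of_def copies_def subgraph_of_def graph_iso_def del_vertex_def induced_def)
  define g where "g = f(w := v)"
  \<comment> \<open>No vertex is its own neighbour, which keeps the extended map injective.\<close>
  have vS: "v \<notin> verts S" using S(2) neighbors_subset[OF G, of v] by auto
  have g: "bij_betw g (verts F) (insert v (verts S))"
  proof -
    have "bij_betw g (verts F - {w}) (verts S)"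
      using f by (rule bij_betw_cong[THEN iffD1, rotated]) (auto simp: g_def)
    moreover have "bij_betw g {w} {v}" by (auto simp: g_def)
    ultimately have "bij_betw g ((verts F - {w}) \<union> {w}) (verts S \<union> {v})"
      using vS by (intro bij_betw_combine) auto
    then show ?thesis using w by (simp add: insert_absorb)
  qed
  \<comment> \<open>Only the images of edges of \<open>F\<close> are taken: copies need not be
    induced, so further edges of \<open>G\<close> on these vertices do no harm.\<close>
  let ?T = "UGraph (insert v (verts S)) ((\<lambda>e. g ` e) ` edges F)"
  have eF: "e \<subseteq> verts F" "card e = 2" if "e \<in> edges F" for e
    using that F by (auto simp: simple_graph_def)
  have "simple_graph ?T"
  proof -
    have "card (g ` e) = 2" "g ` e \<subseteq> insert v (verts S)" if "e \<in> edges F" for e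
      using eF[OF that] g by (auto simp: bij_betw_def card_image inj_on_subset)
    then show ?thesis using S(1) by (auto simp: simple_graph_def)
  qed
  moreover have "g ` e \<in> edges G" if e: "e \<in> edges F" for e
  proof (cases "w \<in> e")
    case False
    then have "g ` e = f ` e" by (auto simp: g_def)
    also have "f ` e \<in> edges S" unfolding fe[symmetric] using e False by simp
    finally show ?thesis using S(3) by (rule rev_subsetD)
  next
    case True
    obtain x y where xy: "e = {x, y}" "x \<noteq> y" using eF(2)[OF e] by (auto simp: card_2_iff)
    define u where "u = (if x = w then y else x)"
    have u: "e = {w, u}" "u \<noteq> w" "u \<in> verts F"
      using xy True eF(1)[OF e] by (auto simp: u_def)
    then have "f u \<in> ?N" using f S(2) by (auto simp: bij_betw_def)
    then show ?thesis using u by (simp add: g_def neighbors_def insert_commute)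
  qed
  ultimately have "?T \<in> copies F G"
    using S(2) v neighbors_subset[OF G, of v] g
    by (auto simp: copies_def subgraph_of_def graph_iso_def)
  then show False using free by (auto simp: free_of_def)
qed

section \<open>Extremal numbers as upper bounds\<close>

lemma card_edges_le_ex_edges:
  fixes G :: "nat ugraph"
  assumes "simple_graph G" "free_of F G"
  shows "card (edges G) \<le> ex_edges (card (verts G)) F"
  unfolding ex_edges_def
proof (rule cSup_upper)
  show "bdd_above {card (edges H) |H :: nat ugraph.
      simple_graph H \<and> card (verts H) = card (verts G) \<and> free_of F H}"
    by (rule bdd_aboveI[of _ "2 ^ card (verts G)"]) (auto dest: card_edges_le)
qed (use assms in auto)

lemma card_copies_le_ex_copies:
  fixes G :: "nat ugraph"
  assumes "simple_graph G" "free_of F G"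
  shows "card (copies H G) \<le> ex_copies (card (verts G)) H F"
  unfolding ex_copies_def
proof (rule cSup_upper)
  show "bdd_above {card (copies H K) |K :: nat ugraph.
      simple_graph K \<and> card (verts K) = card (verts G) \<and> free_of F K}"
    by (rule bdd_aboveI[of _ "2 ^ card (verts G) * 2 ^ (2 ^ card (verts G))"])
      (auto dest: card_copies_le[where H = H])
qed (use assms in auto)

text \<open>A supremum of naturals is compared with a real bound through its floor. If no graph is
  admissible, the supremum is 0, and then only \<open>B \<ge> 0\<close> gives the claim.\<close>

lemma mex_le:
  assumes "\<And>G :: nat ugraph. simple_graph G \<Longrightarrow> card (edges G) = m \<Longrightarrow> free_of F G \<Longrightarrow>
      real (card (copies H G)) \<le> B"
    and "B \<ge> 0"
  shows "real (mex m H F) \<le> B"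
proof -
  let ?X = "{card (copies H G) |G :: nat ugraph.
      simple_graph G \<and> card (edges G) = m \<and> free_of F G}"
  have bound: "x \<le> nat \<lfloor>B\<rfloor>" if "x \<in> ?X" for x
    using that assms(1) by (auto simp: le_nat_floor)
  have "Sup ?X \<le> nat \<lfloor>B\<rfloor>"
  proof (cases "?X = {}")
    case True
    then show ?thesis by (simp only: Sup_nat_empty)
  next
    case False
    then show ?thesis using bound by (rule cSup_least)
  qed
  then have "real (mex m H F) \<le> real (nat \<lfloor>B\<rfloor>)" by (simp add: mex_def)
  also have "\<dots> \<le> B" using assms(2) by simp
  finally show ?thesis .
qed

section \<open>Low-degree vertices and their successive deletion\<close>

lemma exists_low_degree_vertex:
  fixes G :: "'a ugraph"
  assumes G: "simple_graph G" and ne: "verts G \<noteq> {}"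
    and pos: "C1 > 0" "\<alpha> > 1" "m > 0"
    and em: "real (card (edges G)) \<le> m"
    and en: "real (card (edges G)) \<le> C1 * real (card (verts G)) powr \<alpha>"
  shows "\<exists>v\<in>verts G. real (card (neighbors G v)) \<le> (2 * C1) powr (1 / \<alpha>) * (2 * m) powr (1 - 1 / \<alpha>)"
    (is "\<exists>v\<in>_. _ \<le> ?D")
proof (rule ccontr)
  assume "\<not> ?thesis"
  then have big: "\<And>v. v \<in> verts G \<Longrightarrow> ?D < real (card (neighbors G v))" by force
  let ?n = "real (card (verts G))"
  have fin: "finite (verts G)" using G by (simp add: simple_graph_def)
  have n: "?n > 0" using fin ne by (simp add: card_gt_0_iff)
  have D: "?D > 0" using pos by simp
  have "?n * ?D = (\<Sum>v\<in>verts G. ?D)" by simp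
  also have "\<dots> < (\<Sum>v\<in>verts G. real (card (neighbors G v)))"
    using fin ne big by (intro sum_strict_mono) auto
  also have "\<dots> = 2 * real (card (edges G))"
    using sum_card_neighbors[OF G] by (metis of_nat_mult of_nat_numeral of_nat_sum)
  \<comment> \<open>This inequality is used twice below: with the bound in terms of
    \<open>?n\<close> it gives fact \<open>1\<close>, with the bound \<open>m\<close> it gives fact
    \<open>2\<close>.\<close>
  finally have nD: "?n * ?D < 2 * real (card (edges G))" .
  have "?n * ?D < 2 * C1 * ?n powr \<alpha>" using nD en by simp
  also have "\<dots> = ?n * (2 * C1 * ?n powr (\<alpha> - 1))" using n by (simp add: powr_diff)
  finally have 1: "?D < 2 * C1 * ?n powr (\<alpha> - 1)" using n by simp
  have 2: "(?n * ?D) powr (\<alpha> - 1) < (2 * m) powr (\<alpha> - 1)"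
    using nD em n D pos by (intro powr_less_mono2) auto
  \<comment> \<open>\<open>?D\<close> is chosen to solve x powr \<alpha> = 2 * C1 * (2 * m) powr
    (\<alpha> - 1). Bounding one factor by \<open>1\<close> produces the product
    \<open>?n * ?D\<close>, to which \<open>2\<close> applies; this eliminates the number of
    vertices and returns to the start of the chain with a strict inequality.\<close>
  have "?D powr \<alpha> = ?D * ?D powr (\<alpha> - 1)" using D by (simp add: powr_diff)
  also have "\<dots> < 2 * C1 * ?n powr (\<alpha> - 1) * ?D powr (\<alpha> - 1)"
    using 1 D by (intro mult_strict_right_mono) auto
  also have "\<dots> = 2 * C1 * (?n * ?D) powr (\<alpha> - 1)"
    using n D by (simp add: powr_mult)
  also have "\<dots> < 2 * C1 * (2 * m) powr (\<alpha> - 1)" using 2 pos by simp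
  also have "\<dots> = ?D powr \<alpha>"
  proof -
    have "(1 - 1 / \<alpha>) * \<alpha> = \<alpha> - 1" using pos by (simp add: field_simps)
    then show ?thesis using pos by (simp add: powr_mult powr_powr)
  qed
  finally show False by simp
qed

text \<open>The real \<open>m\<close> is only an upper bound for the number of edges and stays fixed
  while \<open>G\<close> shrinks, so the threshold \<open>?D\<close> is the same at every deletion.
  The bound is linear in \<open>card (edges G)\<close>, hence additive when a vertex and its
  incident edges are removed.\<close>

lemma card_cliques_le_edges:
  fixes G :: "nat ugraph" and F :: "'a ugraph"
  assumes F: "simple_graph F" "verts F \<noteq> {}" and r: "r \<ge> 1"
    and C: "C1 > 0" "C2 > 0" "\<alpha> > 1" "\<beta> > 1" "m > 0"
    and exF: "\<forall>n\<ge>1. real (ex_edges n F) \<le> C1 * real n powr \<alpha>"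
    and exK: "\<forall>n\<ge>1. real (MIN v\<in>verts F. ex_copies n (complete_graph r) (del_vertex F v))
                     \<le> C2 * real n powr \<beta>"
    and G: "simple_graph G" "free_of F G" "real (card (edges G)) \<le> m"
  shows "real (card (cliques (Suc r) G)) \<le>
    C2 * ((2 * C1) powr (1 / \<alpha>) * (2 * m) powr (1 - 1 / \<alpha>)) powr (\<beta> - 1) * real (card (edges G))"
    (is "_ \<le> C2 * ?D powr _ * _")
  using G
proof (induction "card (verts G)" arbitrary: G rule: less_induct)
  case less
  have fin: "finite (verts G)" using less.prems by (simp add: simple_graph_def)
  show ?case
  proof (cases "verts G = {}")
    case True
    then have "cliques (Suc r) G = {}" by (auto simp: cliques_def)
    then show ?thesis using C by simp
  next
    case False
    have "real (card (edges G)) \<le> C1 * real (card (verts G)) powr \<alpha>"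
    proof -
      have "card (verts G) \<ge> 1" using False fin by (simp add: Suc_le_eq card_gt_0_iff)
      then have "real (ex_edges (card (verts G)) F) \<le> C1 * real (card (verts G)) powr \<alpha>"
        using exF by blast
      then show ?thesis using card_edges_le_ex_edges[OF less.prems(1,2)] by linarith
    qed
    then obtain v where v: "v \<in> verts G" and vD: "real (card (neighbors G v)) \<le> ?D"
      using exists_low_degree_vertex[OF less.prems(1) False C(1,3,5) less.prems(3)] by blast
    let ?d = "card (neighbors G v)" and ?N = "induced G (neighbors G v)"
    have split: "real (card (edges G)) = real (card (edges (del_vertex G v))) + real ?d"
      using card_edges_del_vertex[OF less.prems(1), of v] by simp
    have IH: "real (card (cliques (Suc r) (del_vertex G v)))
        \<le> C2 * ?D powr (\<beta> - 1) * real (card (edges (del_vertex G v)))"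
    proof (rule less.hyps)
      show "card (verts (del_vertex G v)) < card (verts G)"
        unfolding del_vertex_def ugraph.sel using fin v by (rule card_Diff1_less)
      show "real (card (edges (del_vertex G v))) \<le> m" using split less.prems(3) by simp
    qed (fact simple_graph_del_vertex[OF less.prems(1)] free_of_del_vertex[OF less.prems(2)])+
    have N: "simple_graph ?N"
      using less.prems(1) neighbors_subset[OF less.prems(1), of v]
      by (auto intro!: simple_graph_induced)
    have nb: "real (card (cliques r ?N)) \<le> C2 * ?D powr (\<beta> - 1) * real ?d"
    \<comment> \<open>The hypothesis \<open>exK\<close> starts at \<open>n = 1\<close>, so an
      isolated \<open>v\<close> is treated apart: an empty neighbourhood has no clique of size
      \<open>r \<ge> 1\<close>.\<close>
    proof (cases "?d = 0")
      case True
      have "finite (neighbors G v)"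
        using fin neighbors_subset[OF less.prems(1), of v] by (auto intro: finite_subset)
      then have "cliques r ?N = {}" using True r by (auto simp: cliques_def induced_def)
      then show ?thesis using True by simp
    next
      case False
      let ?ex = "\<lambda>w. ex_copies ?d (complete_graph r) (del_vertex F w)"
      \<comment> \<open>The minimum is attained, but the vertex attaining it may change with the
        degree \<open>?d\<close>; hence \<open>w\<close> is picked anew at each deletion.\<close>
      have "(MIN w\<in>verts F. ?ex w) \<in> ?ex ` verts F"
        using F by (intro Min_in) (auto simp: simple_graph_def)
      then obtain w where w: "w \<in> verts F" "(MIN w\<in>verts F. ?ex w) = ?ex w" by auto
      have "card (copies (complete_graph r) ?N) \<le> ?ex w"
        using card_copies_le_ex_copies[OF N
            free_of_del_vertex_neighborhood[OF less.prems(1,2) F(1) v w(1)]]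
        by (simp add: induced_def)
      then have "real (card (cliques r ?N)) \<le> real (?ex w)"
        by (simp add: card_copies_complete[OF N])
      also have "\<dots> \<le> C2 * real ?d powr \<beta>"
        using exK False w(2) by (metis One_nat_def Suc_leI neq0_conv)
      \<comment> \<open>One factor \<open>?d\<close> is kept to pay for the deleted edges; the
        remaining power is bounded by that of \<open>?D\<close>, as
        \<open>\<beta> > 1\<close>.\<close>
      also have "\<dots> = C2 * real ?d powr (\<beta> - 1) * real ?d"
        using False by (simp add: powr_diff)
      also have "\<dots> \<le> C2 * ?D powr (\<beta> - 1) * real ?d"
        using C vD by (intro mult_right_mono mult_left_mono powr_mono2) auto
      finally show ?thesis .
    qed
    have "real (card (cliques (Suc r) G)) \<le>
        real (card (cliques (Suc r) (del_vertex G v))) + real (card (cliques r ?N))"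
      using card_cliques_Suc_le[OF less.prems(1), of r v] by linarith
    also have "\<dots> \<le> C2 * ?D powr (\<beta> - 1) * real (card (edges G))"
      using IH nb by (simp add: split distrib_left)
    finally show ?thesis .
  qed
qed

theorem theorem1p3:
  fixes F :: "'a ugraph" and C1 C2 \<alpha> \<beta> :: real
  assumes "simple_graph F" and "card (verts F) \<ge> 3"
    and "C1 > 0" and "C2 > 0" and "\<alpha> > 1" and "\<beta> > 1"
    and "\<forall>n\<ge>1. real (ex_edges n F) \<le> C1 * real n powr \<alpha>"
  shows "\<exists>C::real. \<forall>r\<ge>2.
           (\<forall>n\<ge>1. real (MIN v\<in>verts F. ex_copies n (complete_graph r) (del_vertex F v))
                     \<le> C2 * real n powr \<beta>) \<longrightarrow>
           (\<forall>m. real (mex m (complete_graph (r + 1)) F)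
                  \<le> C * real m powr (1 + (\<beta> - 1) * (1 - 1 / \<alpha>)))"
proof -
  \<comment> \<open>\<open>c\<close> is the coefficient of m powr (1 - 1 / \<alpha>) in the degree
    threshold. As \<open>C\<close> is built from \<open>C1\<close>, \<open>C2\<close>, \<alpha> and
    \<beta> alone, it can be fixed before \<open>r\<close> and \<open>m\<close>.\<close>
  define c where "c = (2 * C1) powr (1 / \<alpha>) * 2 powr (1 - 1 / \<alpha>)"
  define C where "C = C2 * c powr (\<beta> - 1)"
  let ?f = "1 + (\<beta> - 1) * (1 - 1 / \<alpha>)"
  have "real (mex m (complete_graph (r + 1)) F) \<le> C * real m powr ?f"
    if r: "r \<ge> 2" and exK: "\<forall>n\<ge>1. real (MIN v\<in>verts F. ex_copies n (complete_graph r) (del_vertex F v))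
                     \<le> C2 * real n powr \<beta>" for r m
  proof (rule mex_le)
    show "0 \<le> C * real m powr ?f" using assms(4) by (simp add: C_def)
    fix G :: "nat ugraph"
    assume G: "simple_graph G" "card (edges G) = m" "free_of F G"
    have "real (card (cliques (Suc r) G)) \<le> C * real m powr ?f"
    proof (cases "m = 0")
      \<comment> \<open>Here the right-hand side is 0, since \<open>0 powr x = 0\<close> for every
        \<open>x\<close>. So there must be no clique at all, and indeed one on \<open>r + 1\<close>
        vertices would contain an edge.\<close>
      case True
      have "cliques (Suc r) G = {}"
      proof (rule equals0I)
        fix S assume S: "S \<in> cliques (Suc r) G"
        then have "2 \<le> card S" using r by (auto simp: cliques_def)
        then obtain e where "e \<subseteq> S" "card e = 2" using obtain_subset_with_card_n by metis
        moreover have "edges G = {}" using G(2) True finite_edges[OF G(1)] by simp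
        ultimately show False using S by (auto simp: cliques_def)
      qed
      then show ?thesis using True by simp
    next
      case False
      have "verts F \<noteq> {}" using assms(2) by auto
      then have "real (card (cliques (Suc r) G)) \<le>
          C2 * ((2 * C1) powr (1 / \<alpha>) * (2 * real m) powr (1 - 1 / \<alpha>)) powr (\<beta> - 1) * real m"
        using card_cliques_le_edges[where m = "real m", OF assms(1) _ _ assms(3-6) _ assms(7) exK G(1,3)]
          r False G(2) by simp
      also have "(2 * C1) powr (1 / \<alpha>) * (2 * real m) powr (1 - 1 / \<alpha>) = c * real m powr (1 - 1 / \<alpha>)"
        by (simp add: c_def powr_mult)
      \<comment> \<open>The linear factor in the number of edges is written as a power with exponent
        1, which supplies the summand 1 of \<open>?f\<close>.\<close>
      also have "C2 * (c * real m powr (1 - 1 / \<alpha>)) powr (\<beta> - 1) * real m =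
          C * (real m powr ((1 - 1 / \<alpha>) * (\<beta> - 1)) * real m powr 1)"
        using False by (simp add: C_def c_def powr_mult powr_powr)
      also have "\<dots> = C * real m powr ?f"
        by (simp only: powr_add[symmetric] add.commute mult.commute)
      finally show ?thesis .
    qed
    then show "real (card (copies (complete_graph (r + 1)) G)) \<le> C * real m powr ?f"
      by (simp add: card_copies_complete[OF G(1)])
  qed
  then show ?thesis by blast
qed

end
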